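(* For all positive integers $n$, the functions $\Upsilon_T:[0,2]\to\mathbb{R}$ of the torus knots $T=T_{3,3n+1},T_{3,3n+2},T_{4,4n+1},T_{4,4n+3}$ are given on $[0,1]$ by $$\Upsilon_{T_{3,3n+1}}(t)=\begin{cases}-3nt&\text{for }0\leq t\leq\frac23\\-2n&\text{for }\frac23\leq t\leq 1\end{cases},$$ $$\Upsilon_{T_{3,3n+2}}(t)=\begin{cases}-(3n+1)t&\text{for }0\leq t\leq\frac23\\-2n-t&\text{for }\frac23\leq t\leq 1\end{cases},$$ $$\Upsilon_{T_{4,4n+1}}(t)=\begin{cases}-6nt&\text{for }0\leq t\leq\frac12\\-2n-2nt&\text{for }\frac12\leq t\leq 1\end{cases},$$ $$\Upsilon_{T_{4,4n+3}}(t)=\begin{cases}-(6n+3)t&\text{for }0\leq t\leq\frac12\\-2n-(2n+3)t&\text{for }\frac12\leq t\leq\frac23\\-2n-2-2nt&\text{for }\frac23\leq t\leq 1\end{cases},$$ and on $[1,2]$ they are determined by the symmetry $\Upsilon_T(t)=\Upsilon_T(2-t)$.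
   Context: For coprime positive integers $p,q$, $T_{p,q}$ denotes the positive torus knot. $\Upsilon$ is the concordance invariant of Ozsváth, Stipsicz, and Szabó, which assigns to a knot $K$ a function $\Upsilon_K:[0,2]\to\mathbb{R}$. For torus knots it is given (Ozsváth–Stipsicz–Szabó) as follows. Write the symmetrized Alexander polynomial $$\Delta(T_{p,q})=t^{-\frac{(p-1)(q-1)}{2}}\frac{(t^{pq}-1)(t-1)}{(t^p-1)(t^q-1)}=\sum_{k=0}^{l}(-1)^kt^{\alpha_k}$$ with $(\alpha_k)_{k=0}^l$ a decreasing sequence of integers, and define integers $m_0=0$, $m_{2k}=m_{2k-1}-1$, $m_{2k+1}=m_{2k}-2(\alpha_{2k}-\alpha_{2k+1})+1$. Then $\Upsilon_{T_{p,q}}(t)=\max_{0\leq 2k\leq l}\{m_{2k}-t\alpha_{2k}\}$ for $t\in[0,2]$. It is a known property of $\Upsilon$ that $\Upsilon_K(t)=\Upsilon_K(2-t)$. *)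

theory Defs
  imports Complex_Main "HOL-Computational_Algebra.Formal_Laurent_Series"
begin

text \<open>
  Laurent polynomials are elements of the field of formal Laurent series over the rationals,
  so the quotient below is a genuine quotient. For coprime \<open>p\<close> and \<open>q\<close> the product
  \<open>(p - 1) * (q - 1)\<close> is even, hence the integer division by 2 is exact.
\<close>

definition torus_alexander :: "nat \<Rightarrow> nat \<Rightarrow> rat fls" where
  "torus_alexander p q =
     fls_X_intpow (- ((int p - 1) * (int q - 1) div 2)) *
     (((fls_X ^ (p * q) - 1) * (fls_X - 1)) / ((fls_X ^ p - 1) * (fls_X ^ q - 1)))"

text \<open>The list \<open>\<alpha>\<close> has entries \<open>\<alpha>\<^sub>0 > \<dots> > \<alpha>\<^sub>l\<close>, that is, \<open>l = length \<alpha> - 1\<close>.\<close>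

definition alternating_expansion :: "rat fls \<Rightarrow> int list \<Rightarrow> bool" where
  "alternating_expansion D \<alpha> \<longleftrightarrow>
     sorted_wrt (>) \<alpha> \<and> D = (\<Sum>k<length \<alpha>. (- 1) ^ k * fls_X_intpow (\<alpha> ! k))"

lemma alternating_expansion_support:
  assumes "alternating_expansion D \<alpha>"
  shows "set \<alpha> = {i. fls_nth D i \<noteq> 0}"
proof -
  have s: "sorted_wrt (>) \<alpha>"
    and D: "D = (\<Sum>k<length \<alpha>. (- 1) ^ k * fls_X_intpow (\<alpha> ! k))"
    using assms by (auto simp: alternating_expansion_def)
  have sgn: "fls_nth ((- 1) ^ k * f) i = (- 1) ^ k * fls_nth f i" for k i and f :: "rat fls"
    by (cases "even k") auto
  have nth: "fls_nth D i = (\<Sum>k<length \<alpha>. if \<alpha> ! k = i then (- 1) ^ k else 0)" for i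
    unfolding D fls_nth_sum by (intro sum.cong) (auto simp: sgn)
  have inj: "\<alpha> ! j = \<alpha> ! k \<Longrightarrow> j < length \<alpha> \<Longrightarrow> k < length \<alpha> \<Longrightarrow> j = k" for j k
    using s by (metis less_irrefl linorder_neqE_nat sorted_wrt_nth_less)
  have "fls_nth D (\<alpha> ! k) = (- 1) ^ k" if "k < length \<alpha>" for k
  proof -
    have "fls_nth D (\<alpha> ! k) = (\<Sum>j<length \<alpha>. if j = k then (- 1) ^ j else 0)"
      unfolding nth using inj that by (intro sum.cong) auto
    then show ?thesis using that by simp
  qed
  moreover have "fls_nth D i = 0" if "i \<notin> set \<alpha>" for i
    unfolding nth using that by (intro sum.neutral) (auto simp: in_set_conv_nth)
  ultimately show ?thesis
    by (auto simp: in_set_conv_nth) (metis in_set_conv_nth)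
qed

lemma alternating_expansion_unique:
  assumes "alternating_expansion D \<alpha>" "alternating_expansion D \<beta>"
  shows "\<alpha> = \<beta>"
proof -
  have eq: "set \<alpha> = set \<beta>"
    using assms alternating_expansion_support by metis
  have "sorted_wrt (<) (rev \<alpha>)" "sorted_wrt (<) (rev \<beta>)"
    using assms by (auto simp: alternating_expansion_def sorted_wrt_rev)
  then have "rev \<alpha> = rev \<beta>"
    using eq strict_sorted_equal by (metis set_rev)
  then show ?thesis by simp
qed

definition torus_exponents :: "nat \<Rightarrow> nat \<Rightarrow> int list" where
  "torus_exponents p q = (THE \<alpha>. alternating_expansion (torus_alexander p q) \<alpha>)"

fun maslov :: "int list \<Rightarrow> nat \<Rightarrow> int" where
  "maslov \<alpha> 0 = 0"
| "maslov \<alpha> (Suc k) =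
     (if even k then maslov \<alpha> k - 2 * (\<alpha> ! k - \<alpha> ! Suc k) + 1 else maslov \<alpha> k - 1)"

text \<open>
  The Upsilon function of the torus knot \<open>T\<^sub>p\<^sub>,\<^sub>q\<close>, by the formula of Ozsvath, Stipsicz and Szabo
  in terms of the Alexander polynomial. Only arguments \<open>t\<close> in \<open>[0,2]\<close> are meaningful.
\<close>

definition torus_upsilon :: "nat \<Rightarrow> nat \<Rightarrow> real \<Rightarrow> real" where
  "torus_upsilon p q t =
     (let \<alpha> = torus_exponents p q in
      Max {real_of_int (maslov \<alpha> (2 * k)) - t * real_of_int (\<alpha> ! (2 * k)) | k.
             2 * k < length \<alpha>})"

end

theory Submission
  imports Defs
begin

text \<open>
  The exponents of the Alexander polynomial of a torus knot come in pairs
  \<open>\<alpha>\<^sub>2\<^sub>k, \<alpha>\<^sub>2\<^sub>k\<^sub>+\<^sub>1\<close>. Writing \<open>b k = \<alpha>\<^sub>2\<^sub>k\<close> and \<open>M k\<close> for the sum of the first \<open>k\<close> gaps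
  \<open>\<alpha>\<^sub>2\<^sub>j - \<alpha>\<^sub>2\<^sub>j\<^sub>+\<^sub>1\<close>, the Maslov recursion gives \<open>m\<^sub>2\<^sub>k = - 2 M k\<close>, so Upsilon is the maximum of
  \<open>- 2 M k - t b k\<close>. In the semigroup generated by \<open>p\<close> and \<open>q\<close> the elements below the conductor
  form runs, and \<open>M k\<close> counts the elements before the \<open>k\<close>-th run. For the four families the
  runs have length 1, then 2 (then 3 if \<open>p = 4\<close>), and inside each group the starting points
  form an arithmetic progression with difference \<open>p\<close>; hence the polynomial identity reduces to
  geometric sums, and \<open>- 2 M k - t b k\<close> is piecewise linear in \<open>k\<close> and maximal at a change of
  the run length or at \<open>k = 0\<close>. The symmetry \<open>t \<mapsto> 2 - t\<close> is the reflection \<open>k \<mapsto> L - k\<close>, because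
  \<open>M (L - k) - M k = b k\<close>.
\<close>

section \<open>Laurent monomials and geometric sums\<close>

lemma fls_X_intpow_add: "(fls_X_intpow (i + j) :: rat fls) = fls_X_intpow i * fls_X_intpow j"
  by (simp add: fls_X_intpow_times_fls_X_intpow)

lemma fls_X_intpow_of_nat: "(fls_X_intpow (int k) :: rat fls) = fls_X ^ k"
  by (simp add: fls_X_power_conv_shift_1)

lemma fls_X_power_neq_1:
  assumes "k > 0"
  shows "(fls_X :: rat fls) ^ k \<noteq> 1"
proof
  assume "(fls_X :: rat fls) ^ k = 1"
  then have "fls_nth ((fls_X :: rat fls) ^ k) 0 = fls_nth 1 0" by simp
  then show False using assms by (simp add: fls_X_power_nth)
qed

text \<open>A geometric sum with ratio \<open>fls_X ^ d\<close>, listed from its top exponent down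
  to \<open>e\<close> to match the decreasing order of \<alpha>.\<close>

lemma sum_fls_X_intpow_telescope:
  "((fls_X :: rat fls) ^ d - 1) *
     (\<Sum>k<m. fls_X_intpow (int (e + d * m) - int d * (int k + 1))) =
   fls_X ^ e * (fls_X ^ (d * m) - 1)"
proof (induction m)
  case (Suc m)
  let ?S = "\<Sum>k<m. fls_X_intpow (int (e + d * m) - int d * (int k + 1)) :: rat fls"
  \<comment> \<open>The front term is split off: raising \<open>m\<close> by one moves every
    exponent up by \<open>d\<close>, so after an index shift the remainder is the sum for
    \<open>m\<close>.\<close>
  have "(\<Sum>k<Suc m. fls_X_intpow (int (e + d * Suc m) - int d * (int k + 1)) :: rat fls) =
      fls_X_intpow (int (e + d * m)) + ?S"
    by (simp add: sum.lessThan_Suc_shift algebra_simps del: sum.lessThan_Suc)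
  also have "\<dots> = fls_X ^ (e + d * m) + ?S"
    unfolding fls_X_intpow_of_nat ..
  finally have eq: "(\<Sum>k<Suc m. fls_X_intpow (int (e + d * Suc m) - int d * (int k + 1))) =
      fls_X ^ (e + d * m) + ?S" .
  have "(fls_X ^ d - 1) * (fls_X ^ (e + d * m) + ?S) =
      (fls_X ^ d - 1) * fls_X ^ (e + d * m) + fls_X ^ e * (fls_X ^ (d * m) - 1)"
    unfolding Suc.IH[symmetric] by (rule distrib_left)
  also have "\<dots> = fls_X ^ e * (fls_X ^ (d * Suc m) - 1)"
    by (simp add: algebra_simps power_add)
  finally show ?case unfolding eq .
qed simp

text \<open>Each pair factors as \<open>fls_X ^ r - 1\<close> times a monomial, leaving a geometric
  sum. For \<open>m > 0\<close> the assumption says that \<open>e\<close> is the lowest exponent,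
  that of the second term of the last pair.\<close>

lemma sum_fls_X_intpow_block:
  assumes "c - int r = int e + int d * int m - int d"
  shows "((fls_X :: rat fls) ^ d - 1) *
      (\<Sum>k<m. fls_X_intpow (c - int d * int k) - fls_X_intpow (c - int d * int k - int r)) =
    (fls_X ^ r - 1) * fls_X ^ e * (fls_X ^ (d * m) - 1)"
proof -
  have "(fls_X_intpow (c - int d * int k) - fls_X_intpow (c - int d * int k - int r) :: rat fls) =
      (fls_X ^ r - 1) * fls_X_intpow (int (e + d * m) - int d * (int k + 1))" for k
  proof -
    have 1: "c - int d * int k - int r = int (e + d * m) - int d * (int k + 1)"
      using assms by (simp add: algebra_simps)
    have "c - int d * int k = int r + (c - int d * int k - int r)" by simp
    then have "(fls_X_intpow (c - int d * int k) :: rat fls) =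
        fls_X ^ r * fls_X_intpow (c - int d * int k - int r)"
      by (metis fls_X_intpow_add fls_X_intpow_of_nat)
    then show ?thesis unfolding 1 by (simp add: algebra_simps)
  qed
  then have "((fls_X :: rat fls) ^ d - 1) *
      (\<Sum>k<m. fls_X_intpow (c - int d * int k) - fls_X_intpow (c - int d * int k - int r)) =
    (fls_X ^ r - 1) * ((fls_X ^ d - 1) *
      (\<Sum>k<m. fls_X_intpow (int (e + d * m) - int d * (int k + 1))))"
    by (simp add: sum_distrib_left mult_ac)
  then show ?thesis unfolding sum_fls_X_intpow_telescope by (simp add: mult_ac)
qed

text \<open>The progression is required only below \<open>m\<close>, so that exponents defined by
  cases can be treated one group at a time.\<close>

lemma sum_fls_X_intpow_arith_prog:
  assumes "c - int r = int e + int d * int m - int d"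
    and "\<And>k. k < m \<Longrightarrow> \<beta> k = c - int d * int k"
    and "\<And>k. k < m \<Longrightarrow> \<gamma> k = c - int d * int k - int r"
  shows "((fls_X :: rat fls) ^ d - 1) * (\<Sum>k<m. fls_X_intpow (\<beta> k) - fls_X_intpow (\<gamma> k)) =
    (fls_X ^ r - 1) * fls_X ^ e * (fls_X ^ (d * m) - 1)"
  unfolding sum_fls_X_intpow_block[OF assms(1), symmetric] using assms(2,3) by simp

lemma sum_lessThan_add:
  fixes f :: "nat \<Rightarrow> 'a::comm_monoid_add"
  shows "(\<Sum>k<m + n. f k) = (\<Sum>k<m. f k) + (\<Sum>k<n. f (m + k))"
  by (induction n) (simp_all add: add.assoc)

section \<open>Alexander polynomials and their exponent lists\<close>

text \<open>The factor \<open>fls_X ^ q - 1\<close> divides \<open>fls_X ^ (p * q) - 1\<close> with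
  a geometric sum as quotient. Cancelling it leaves only \<open>fls_X ^ p - 1\<close> to clear, and
  \<open>p\<close> terms on the right.\<close>

lemma torus_alexander_eqI:
  assumes "p > 0" "q > 0" "(int p - 1) * (int q - 1) = 2 * g"
    and "(fls_X ^ p - 1) * P = (fls_X - 1) * (\<Sum>i<p. (fls_X ^ q) ^ i)"
  shows "torus_alexander p q = fls_X_intpow (- g) * P"
proof -
  have nz: "(fls_X ^ p - 1) * (fls_X ^ q - 1) \<noteq> (0 :: rat fls)"
    using assms by (simp add: fls_X_power_neq_1)
  have "(fls_X ^ (p * q) - 1) * (fls_X - 1) =
      (fls_X ^ q - 1) * ((fls_X - 1) * (\<Sum>i<p. (fls_X ^ q) ^ i) :: rat fls)"
    using power_diff_1_eq[of "fls_X ^ q :: rat fls" p]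
    by (simp add: mult_ac flip: power_mult)
  also have "\<dots> = P * ((fls_X ^ p - 1) * (fls_X ^ q - 1))"
    unfolding assms(4)[symmetric] by (simp only: mult_ac)
  finally have "((fls_X ^ (p * q) - 1) * (fls_X - 1)) / ((fls_X ^ p - 1) * (fls_X ^ q - 1)) = P"
    using nz by simp
  then show ?thesis unfolding torus_alexander_def assms(3) by simp
qed

lemma torus_exponents_eqI:
  "alternating_expansion (torus_alexander p q) \<alpha> \<Longrightarrow> torus_exponents p q = \<alpha>"
  unfolding torus_exponents_def using alternating_expansion_unique by blast

text \<open>The last index is even because the Alexander polynomial has value 1 at 1, so its
  alternating expansion has an odd number of terms.\<close>

definition staircase :: "nat \<Rightarrow> (nat \<Rightarrow> int) \<Rightarrow> (nat \<Rightarrow> int) \<Rightarrow> int list" where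
  "staircase L b M =
     map (\<lambda>i. if even i then b (i div 2) else b (i div 2) - (M (Suc (i div 2)) - M (i div 2)))
       [0..<2 * L + 1]"

lemma length_staircase: "length (staircase L b M) = 2 * L + 1"
  by (simp add: staircase_def)

lemma staircase_even: "k \<le> L \<Longrightarrow> staircase L b M ! (2 * k) = b k"
  by (simp add: staircase_def del: upt_Suc)

lemma staircase_odd:
  "k < L \<Longrightarrow> staircase L b M ! Suc (2 * k) = b k - (M (Suc k) - M k)"
  by (simp add: staircase_def del: upt_Suc)

text \<open>The \<open>+ 1\<close> of one Maslov step cancels against the \<open>- 1\<close> of the
  next, so two steps subtract twice a gap and the gaps telescope.\<close>

lemma maslov_staircase:
  assumes "M 0 = 0" "k \<le> L"
  shows "maslov (staircase L b M) (2 * k) = - 2 * M k"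
  using assms(2)
proof (induction k)
  case (Suc k)
  then show ?case
    using staircase_even[of k L b M] staircase_odd[of k L b M] by simp
qed (simp add: assms)

lemma sorted_staircase:
  assumes "\<And>k. k < L \<Longrightarrow> M k < M (Suc k)"
    and "\<And>k. k < L \<Longrightarrow> b (Suc k) < b k - (M (Suc k) - M k)"
  shows "sorted_wrt (>) (staircase L b M)"
proof -
  have "staircase L b M ! Suc i < staircase L b M ! i" if "Suc i < 2 * L + 1" for i
  proof (cases "even i")
    case True
    then obtain k where "i = 2 * k" by blast
    with that assms(1)[of k] show ?thesis by (simp add: staircase_even staircase_odd)
  next
    case False
    then obtain k where k: "i = Suc (2 * k)" using oddE by fastforce
    with that assms(2)[of k] staircase_even[of "Suc k" L b M] show ?thesis
      by (simp add: staircase_odd)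
  qed
  moreover have "transp ((>) :: int \<Rightarrow> int \<Rightarrow> bool)" by (auto intro: transpI)
  ultimately show ?thesis
    by (subst sorted_wrt_iff_nth_Suc_transp) (simp_all add: length_staircase)
qed

lemma sum_staircase:
  "(\<Sum>k<length (staircase L b M). (- 1) ^ k * fls_X_intpow (staircase L b M ! k)) =
   (\<Sum>k<L. fls_X_intpow (b k) - fls_X_intpow (b k - (M (Suc k) - M k))) +
     (fls_X_intpow (b L) :: rat fls)"
proof -
  have split: "(\<Sum>k<2 * m. f k) = (\<Sum>k<m. f (2 * k) + f (Suc (2 * k)))"
    for m and f :: "nat \<Rightarrow> rat fls"
    by (induction m) (simp_all add: add.assoc)
  show ?thesis
    unfolding length_staircase
    by (simp add: split staircase_even staircase_odd)
qed

text \<open>The last hypothesis is the polynomial identity cleared of denominators, with all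
  exponents raised by \<open>g\<close>. Uniqueness of alternating expansions then identifies
  \<open>torus_exponents p q\<close> with the staircase.\<close>

lemma torus_upsilon_eq_Max:
  assumes "M 0 = 0"
    and "\<And>k. k < L \<Longrightarrow> M k < M (Suc k)"
    and "\<And>k. k < L \<Longrightarrow> b (Suc k) < b k - (M (Suc k) - M k)"
    and "p > 0" "q > 0" "(int p - 1) * (int q - 1) = 2 * g"
    and "(fls_X ^ p - 1) *
        ((\<Sum>k<L. fls_X_intpow (b k + g) - fls_X_intpow (b k + g - (M (Suc k) - M k))) +
          fls_X_intpow (b L + g)) =
      (fls_X - 1 :: rat fls) * (\<Sum>i<p. (fls_X ^ q) ^ i)"
  shows "torus_upsilon p q t =
    Max ((\<lambda>k. - 2 * real_of_int (M k) - t * real_of_int (b k)) ` {..L})"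
proof -
  have shift: "fls_X_intpow (- g) * fls_X_intpow (i + g) = (fls_X_intpow i :: rat fls)" for i
    by (metis fls_X_intpow_add add.commute add_diff_cancel_right' diff_conv_add_uminus)
  have shift': "fls_X_intpow (- g) * fls_X_intpow (i + g - j) = (fls_X_intpow (i - j) :: rat fls)"
    for i j using shift[of "i - j"] by (simp add: algebra_simps)
  have "torus_alexander p q =
      (\<Sum>k<L. fls_X_intpow (b k) - fls_X_intpow (b k - (M (Suc k) - M k))) + fls_X_intpow (b L)"
    unfolding torus_alexander_eqI[OF assms(4-7)]
    by (simp only: distrib_left sum_distrib_left right_diff_distrib shift shift')
  then have "alternating_expansion (torus_alexander p q) (staircase L b M)"
    by (simp add: alternating_expansion_def sum_staircase sorted_staircase assms)
  then have "torus_upsilon p q t =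
      Max {real_of_int (maslov (staircase L b M) (2 * k)) -
        t * real_of_int (staircase L b M ! (2 * k)) | k. 2 * k < length (staircase L b M)}"
    by (simp add: torus_upsilon_def torus_exponents_eqI Let_def)
  also have "{real_of_int (maslov (staircase L b M) (2 * k)) -
        t * real_of_int (staircase L b M ! (2 * k)) | k. 2 * k < length (staircase L b M)} =
      (\<lambda>k. real_of_int (maslov (staircase L b M) (2 * k)) -
        t * real_of_int (staircase L b M ! (2 * k))) ` {..L}"
    by (auto simp: length_staircase)
  also have "\<dots> = (\<lambda>k. - 2 * real_of_int (M k) - t * real_of_int (b k)) ` {..L}"
    using assms(1) by (intro image_cong) (simp_all add: maslov_staircase staircase_even)
  finally show ?thesis .
qed

section \<open>Reflection symmetry and maxima over an initial segment\<close>

lemma Max_staircase_symmetric: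
  fixes b M :: "nat \<Rightarrow> int" and t :: real
  assumes "\<And>k. k \<le> L \<Longrightarrow> M (L - k) - M k = b k"
  shows "Max ((\<lambda>k. - 2 * real_of_int (M k) - t * real_of_int (b k)) ` {..L}) =
    Max ((\<lambda>k. - 2 * real_of_int (M k) - (2 - t) * real_of_int (b k)) ` {..L})"
proof -
  have "(\<lambda>k. L - k) ` {..L} = {..L}"
  proof (intro equalityI subsetI)
    fix x assume "x \<in> {..L}"
    then show "x \<in> (\<lambda>k. L - k) ` {..L}" by (intro image_eqI[of _ _ "L - x"]) auto
  qed auto
  then have "(\<lambda>k. - 2 * real_of_int (M k) - (2 - t) * real_of_int (b k)) ` {..L} =
      (\<lambda>k. - 2 * real_of_int (M k) - (2 - t) * real_of_int (b k)) ` (\<lambda>k. L - k) ` {..L}"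
    by simp
  also have "\<dots> =
      (\<lambda>k. - 2 * real_of_int (M (L - k)) - (2 - t) * real_of_int (b (L - k))) ` {..L}"
    by (rule image_image)
  also have "\<dots> = (\<lambda>k. - 2 * real_of_int (M k) - t * real_of_int (b k)) ` {..L}"
  proof (intro image_cong refl)
    fix k assume "k \<in> {..L}"
    \<comment> \<open>Replacing \<open>k\<close> by \<open>L - k\<close> in the hypothesis
      interchanges the two values of \<open>M\<close>, so \<open>b\<close> is odd under the
      reflection.\<close>
    then have "M (L - k) = M k + b k" "b (L - k) = - b k"
      using assms[of k] assms[of "L - k"] by auto
    then show "- 2 * real_of_int (M (L - k)) - (2 - t) * real_of_int (b (L - k)) =
        - 2 * real_of_int (M k) - t * real_of_int (b k)"
      by (simp add: algebra_simps)
  qed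
  finally show ?thesis by simp
qed

lemma Max_image_atMost_eqI:
  fixes f :: "nat \<Rightarrow> real"
  assumes "\<And>k. k \<le> L \<Longrightarrow> f k \<le> v" "i \<le> L" "f i = v"
  shows "Max (f ` {..L}) = v"
  using assms by (intro Max_eqI) auto

section \<open>Polynomial identities for the four families\<close>

text \<open>Below the conductor \<open>6 * n\<close> the runs start at the multiples of 3:
  \<open>n\<close> of length 1, then \<open>n\<close> of length 2.\<close>

lemma torus_upsilon_3_3n1_eq_Max:
  "torus_upsilon 3 (3 * n + 1) t =
    Max ((\<lambda>k. - 2 * real_of_int (if k \<le> n then int k else 2 * int k - int n)
      - t * real_of_int (3 * int n - 3 * int k)) ` {..n + n})"
proof (rule torus_upsilon_eq_Max[where g = "3 * int n"], goal_cases)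
  \<comment> \<open>The seventh premise is the polynomial identity; the others are arithmetic for
    the final \<open>auto\<close>.\<close>
  case 7
  define X :: "rat fls" where "X = fls_X"
  \<comment> \<open>Treating \<open>X ^ n\<close> as a second variable gives an identity of fixed
    degree in \<open>X\<close> and \<open>u\<close>, within reach of \<open>algebra\<close>.\<close>
  define u where "u = X ^ n"
  have X_power: "X ^ (m * n + k) = u ^ m * X ^ k" "X ^ (m * n) = u ^ m" for m k
    by (simp_all add: u_def power_add mult.commute flip: power_mult)
  let ?M = "\<lambda>k. if k \<le> n then int k else 2 * int k - int n"
  let ?b = "\<lambda>k. 3 * int n - 3 * int k"
  let ?f = "\<lambda>k. fls_X_intpow (?b k + 3 * int n)
      - fls_X_intpow (?b k + 3 * int n - (?M (Suc k) - ?M k)) :: rat fls"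
  have 1: "(X ^ 3 - 1) * (\<Sum>k<n. ?f k) =
      (X ^ 1 - 1) * X ^ (3 * n + 2) * (X ^ (3 * n) - 1)"
    unfolding X_def by (rule sum_fls_X_intpow_arith_prog[where c = "6 * int n"]) auto
  have 2: "(X ^ 3 - 1) * (\<Sum>k<n. ?f (n + k)) =
      (X ^ 2 - 1) * X ^ 1 * (X ^ (3 * n) - 1)"
    unfolding X_def by (rule sum_fls_X_intpow_arith_prog[where c = "3 * int n"]) auto
  have 3: "fls_X_intpow (?b (n + n) + 3 * int n) = (1 :: rat fls)" by simp
  show ?case
    unfolding sum_lessThan_add 3 distrib_left X_def[symmetric] 1 2 X_power
    by (simp add: eval_nat_numeral) algebra
qed (auto simp: algebra_simps)

text \<open>The \<open>n + 1\<close> runs of length 1 start at \<open>3 * k\<close>, but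
  \<open>3 * n + 2\<close> comes just before a multiple of 3, so the \<open>n\<close> runs of length
  2 start at \<open>3 * k - 1\<close>. Hence \<open>b\<close> jumps after \<open>n\<close>, while
  the two formulas for \<open>M\<close> agree at \<open>n + 1\<close>.\<close>

lemma torus_upsilon_3_3n2_eq_Max:
  "torus_upsilon 3 (3 * n + 2) t =
    Max ((\<lambda>k. - 2 * real_of_int (if k \<le> n + 1 then int k else 2 * int k - int n - 1)
      - t * real_of_int (if k \<le> n then 3 * int n + 1 - 3 * int k
          else 3 * int n + 2 - 3 * int k)) ` {..Suc n + n})"
proof (rule torus_upsilon_eq_Max[where g = "3 * int n + 1"], goal_cases)
  case 7
  define X :: "rat fls" where "X = fls_X"
  define u where "u = X ^ n"
  have X_power: "X ^ (m * n + k) = u ^ m * X ^ k" "X ^ (m * n) = u ^ m" for m k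
    by (simp_all add: u_def power_add mult.commute flip: power_mult)
  let ?M = "\<lambda>k. if k \<le> n + 1 then int k else 2 * int k - int n - 1"
  let ?b = "\<lambda>k. if k \<le> n then 3 * int n + 1 - 3 * int k else 3 * int n + 2 - 3 * int k"
  let ?f = "\<lambda>k. fls_X_intpow (?b k + (3 * int n + 1))
      - fls_X_intpow (?b k + (3 * int n + 1) - (?M (Suc k) - ?M k)) :: rat fls"
  have 1: "(X ^ 3 - 1) * (\<Sum>k<Suc n. ?f k) =
      (X ^ 1 - 1) * X ^ (3 * n + 1) * (X ^ (3 * Suc n) - 1)"
    unfolding X_def by (rule sum_fls_X_intpow_arith_prog[where c = "6 * int n + 2"]) auto
  have 2: "(X ^ 3 - 1) * (\<Sum>k<n. ?f (Suc n + k)) =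
      (X ^ 2 - 1) * X ^ 1 * (X ^ (3 * n) - 1)"
    unfolding X_def by (rule sum_fls_X_intpow_arith_prog[where c = "3 * int n"]) auto
  have 3: "fls_X_intpow (?b (Suc n + n) + (3 * int n + 1)) = (1 :: rat fls)" by simp
  have 4: "3 * Suc n = 3 * n + 3" by simp
  show ?case
    unfolding sum_lessThan_add 3 distrib_left X_def[symmetric] 1 2 4 X_power
    by (simp add: eval_nat_numeral) algebra
qed (auto simp: algebra_simps)

text \<open>Below the conductor \<open>12 * n\<close> there are \<open>n\<close> runs of each length
  1, 2, 3, all starting at multiples of 4.\<close>

lemma torus_upsilon_4_4n1_eq_Max:
  "torus_upsilon 4 (4 * n + 1) t =
    Max ((\<lambda>k. - 2 * real_of_int (if k \<le> n then int k
        else if k \<le> 2 * n then 2 * int k - int n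
        else 3 * int k - 3 * int n)
      - t * real_of_int (6 * int n - 4 * int k)) ` {..n + n + n})"
proof (rule torus_upsilon_eq_Max[where g = "6 * int n"], goal_cases)
  case 7
  define X :: "rat fls" where "X = fls_X"
  define u where "u = X ^ n"
  have X_power: "X ^ (m * n + k) = u ^ m * X ^ k" "X ^ (m * n) = u ^ m" for m k
    by (simp_all add: u_def power_add mult.commute flip: power_mult)
  let ?M = "\<lambda>k. if k \<le> n then int k
      else if k \<le> 2 * n then 2 * int k - int n
      else 3 * int k - 3 * int n"
  let ?b = "\<lambda>k. 6 * int n - 4 * int k"
  let ?f = "\<lambda>k. fls_X_intpow (?b k + 6 * int n)
      - fls_X_intpow (?b k + 6 * int n - (?M (Suc k) - ?M k)) :: rat fls"
  have 1: "(X ^ 4 - 1) * (\<Sum>k<n. ?f k) =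
      (X ^ 1 - 1) * X ^ (8 * n + 3) * (X ^ (4 * n) - 1)"
    unfolding X_def by (rule sum_fls_X_intpow_arith_prog[where c = "12 * int n"]) auto
  have 2: "(X ^ 4 - 1) * (\<Sum>k<n. ?f (n + k)) =
      (X ^ 2 - 1) * X ^ (4 * n + 2) * (X ^ (4 * n) - 1)"
    unfolding X_def by (rule sum_fls_X_intpow_arith_prog[where c = "8 * int n"]) auto
  have 3: "(X ^ 4 - 1) * (\<Sum>k<n. ?f (n + n + k)) =
      (X ^ 3 - 1) * X ^ 1 * (X ^ (4 * n) - 1)"
    unfolding X_def by (rule sum_fls_X_intpow_arith_prog[where c = "4 * int n"]) auto
  have 4: "fls_X_intpow (?b (n + n + n) + 6 * int n) = (1 :: rat fls)" by simp
  show ?case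
    unfolding sum_lessThan_add 4 distrib_left X_def[symmetric] 1 2 3 X_power
    by (simp add: eval_nat_numeral) algebra
qed (auto simp: algebra_simps)

text \<open>The \<open>n + 1\<close> runs of length 1, \<open>n + 1\<close> of length 2 and
  \<open>n\<close> of length 3 start at \<open>4 * k\<close>, \<open>4 * k - 1\<close> and
  \<open>4 * k - 2\<close>. At each change of length the start advances by 3 instead of 4, which
  causes the break at \<open>t = 2/3\<close>.\<close>

lemma torus_upsilon_4_4n3_eq_Max:
  "torus_upsilon 4 (4 * n + 3) t =
    Max ((\<lambda>k. - 2 * real_of_int (if k \<le> n + 1 then int k
        else if k \<le> 2 * n + 2 then 2 * int k - int n - 1
        else 3 * int k - 3 * int n - 3)
      - t * real_of_int (if k \<le> n then 6 * int n + 3 - 4 * int k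
          else if k \<le> 2 * n + 1 then 6 * int n + 4 - 4 * int k
          else 6 * int n + 5 - 4 * int k)) ` {..Suc n + Suc n + n})"
proof (rule torus_upsilon_eq_Max[where g = "6 * int n + 3"], goal_cases)
  case 7
  define X :: "rat fls" where "X = fls_X"
  define u where "u = X ^ n"
  have X_power: "X ^ (m * n + k) = u ^ m * X ^ k" "X ^ (m * n) = u ^ m" for m k
    by (simp_all add: u_def power_add mult.commute flip: power_mult)
  let ?M = "\<lambda>k. if k \<le> n + 1 then int k
      else if k \<le> 2 * n + 2 then 2 * int k - int n - 1
      else 3 * int k - 3 * int n - 3"
  let ?b = "\<lambda>k. if k \<le> n then 6 * int n + 3 - 4 * int k
      else if k \<le> 2 * n + 1 then 6 * int n + 4 - 4 * int k
      else 6 * int n + 5 - 4 * int k"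
  let ?f = "\<lambda>k. fls_X_intpow (?b k + (6 * int n + 3))
      - fls_X_intpow (?b k + (6 * int n + 3) - (?M (Suc k) - ?M k)) :: rat fls"
  have 1: "(X ^ 4 - 1) * (\<Sum>k<Suc n. ?f k) =
      (X ^ 1 - 1) * X ^ (8 * n + 5) * (X ^ (4 * Suc n) - 1)"
    unfolding X_def by (rule sum_fls_X_intpow_arith_prog[where c = "12 * int n + 6"]) auto
  have 2: "(X ^ 4 - 1) * (\<Sum>k<Suc n. ?f (Suc n + k)) =
      (X ^ 2 - 1) * X ^ (4 * n + 1) * (X ^ (4 * Suc n) - 1)"
    unfolding X_def by (rule sum_fls_X_intpow_arith_prog[where c = "8 * int n + 3"]) auto
  have 3: "(X ^ 4 - 1) * (\<Sum>k<n. ?f (Suc n + Suc n + k)) =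
      (X ^ 3 - 1) * X ^ 1 * (X ^ (4 * n) - 1)"
    unfolding X_def by (rule sum_fls_X_intpow_arith_prog[where c = "4 * int n"]) auto
  have 4: "fls_X_intpow (?b (Suc n + Suc n + n) + (6 * int n + 3)) = (1 :: rat fls)" by simp
  have 5: "4 * Suc n = 4 * n + 4" by simp
  show ?case
    unfolding sum_lessThan_add 4 distrib_left X_def[symmetric] 1 2 3 5 X_power
    by (simp add: eval_nat_numeral) algebra
qed (auto simp: algebra_simps)

section \<open>Evaluation of the maxima and symmetry\<close>

text \<open>Passing a run of length \<open>r\<close> whose successor starts \<open>d\<close> later
  changes the term by \<open>d * t - 2 * r\<close>. Here \<open>d = 3\<close>, and
  \<open>3 * t \<le> 2\<close> rules out any increase.\<close>

lemma torus_upsilon_3_3n1_lower: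
  assumes "0 \<le> t" "t \<le> 2/3"
  shows "torus_upsilon 3 (3 * n + 1) t = - 3 * real n * t"
  unfolding torus_upsilon_3_3n1_eq_Max
proof (rule Max_image_atMost_eqI[where i = 0], goal_cases)
  case (1 k)
  consider (first) "k \<le> n" | (second) "k > n" by linarith
  then show ?case
  proof cases
    case first
    have "0 \<le> real k * (2 - 3 * t)"
      using assms first by (intro mult_nonneg_nonneg) auto
    then show ?thesis using assms first by (simp add: algebra_simps)
  next
    case second
    \<comment> \<open>This is the claimed value minus the term at \<open>k\<close>: the loss over
      \<open>n\<close> runs of length 1 and \<open>k - n\<close> runs of length 2.\<close>
    have "0 \<le> (real k - real n) * (4 - 3 * t) + real n * (2 - 3 * t)"
      using assms second by (intro add_nonneg_nonneg mult_nonneg_nonneg) auto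
    then show ?thesis using assms second by (simp add: algebra_simps)
  qed
qed (auto simp: algebra_simps)

text \<open>Runs of length 1 no longer lower the term, while those of length 2 do since
  \<open>3 * t < 4\<close>; the peak is the first run of length 2.\<close>

lemma torus_upsilon_3_3n1_upper:
  assumes "2/3 \<le> t" "t \<le> 1"
  shows "torus_upsilon 3 (3 * n + 1) t = - 2 * real n"
  unfolding torus_upsilon_3_3n1_eq_Max
proof (rule Max_image_atMost_eqI[where i = n], goal_cases)
  case (1 k)
  consider (first) "k \<le> n" | (second) "k > n" by linarith
  then show ?case
  proof cases
    case first
    have "0 \<le> (real n - real k) * (3 * t - 2)"
      using assms first by (intro mult_nonneg_nonneg) auto
    then show ?thesis using assms first by (simp add: algebra_simps)
  next
    case second
    have "0 \<le> (real k - real n) * (4 - 3 * t)"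
      using assms second by (intro mult_nonneg_nonneg) auto
    then show ?thesis using assms second by (simp add: algebra_simps)
  qed
qed (auto simp: algebra_simps)

lemma torus_upsilon_3_3n1_symmetric:
  "torus_upsilon 3 (3 * n + 1) t = torus_upsilon 3 (3 * n + 1) (2 - t)"
  unfolding torus_upsilon_3_3n1_eq_Max
  by (rule Max_staircase_symmetric) (auto simp: of_nat_diff)

lemma torus_upsilon_3_3n2_lower:
  assumes "0 \<le> t" "t \<le> 2/3"
  shows "torus_upsilon 3 (3 * n + 2) t = - (3 * real n + 1) * t"
  unfolding torus_upsilon_3_3n2_eq_Max
proof (rule Max_image_atMost_eqI[where i = 0], goal_cases)
  case (1 k)
  consider (first) "k \<le> n" | (second) "k > n" by linarith
  then show ?case
  proof cases
    case first
    have "0 \<le> real k * (2 - 3 * t)"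
      using assms first by (intro mult_nonneg_nonneg) auto
    then show ?thesis using assms first by (simp add: algebra_simps)
  next
    case second
    \<comment> \<open>The full difference exceeds this by \<open>2 - 2 * t\<close>, the loss from
      \<open>n\<close> to \<open>n + 1\<close>, where the start advances by only 2.\<close>
    have "0 \<le> (real k - real n - 1) * (4 - 3 * t) + real n * (2 - 3 * t)"
      using assms second by (intro add_nonneg_nonneg mult_nonneg_nonneg) auto
    then show ?thesis using assms second by (simp add: algebra_simps)
  qed
qed (auto simp: algebra_simps)

lemma torus_upsilon_3_3n2_upper:
  assumes "2/3 \<le> t" "t \<le> 1"
  shows "torus_upsilon 3 (3 * n + 2) t = - 2 * real n - t"
  unfolding torus_upsilon_3_3n2_eq_Max
proof (rule Max_image_atMost_eqI[where i = n], goal_cases)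
  case (1 k)
  consider (first) "k \<le> n" | (second) "k > n" by linarith
  then show ?case
  proof cases
    case first
    have "0 \<le> (real n - real k) * (3 * t - 2)"
      using assms first by (intro mult_nonneg_nonneg) auto
    then show ?thesis using assms first by (simp add: algebra_simps)
  next
    case second
    have "0 \<le> (real k - real n - 1) * (4 - 3 * t)"
      using assms second by (intro mult_nonneg_nonneg) auto
    then show ?thesis using assms second by (simp add: algebra_simps)
  qed
qed (auto simp: algebra_simps)

lemma torus_upsilon_3_3n2_symmetric:
  "torus_upsilon 3 (3 * n + 2) t = torus_upsilon 3 (3 * n + 2) (2 - t)"
  unfolding torus_upsilon_3_3n2_eq_Max
  by (rule Max_staircase_symmetric) (auto simp: of_nat_diff)

lemma torus_upsilon_4_4n1_lower:
  assumes "0 \<le> t" "t \<le> 1/2"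
  shows "torus_upsilon 4 (4 * n + 1) t = - 6 * real n * t"
  unfolding torus_upsilon_4_4n1_eq_Max
proof (rule Max_image_atMost_eqI[where i = 0], goal_cases)
  case (1 k)
  consider (first) "k \<le> n" | (second) "k > n" "k \<le> 2 * n" | (third) "k > 2 * n" by linarith
  then show ?case
  proof cases
    case first
    have "0 \<le> real k * (2 - 4 * t)"
      using assms first by (intro mult_nonneg_nonneg) auto
    then show ?thesis using assms first by (simp add: algebra_simps)
  next
    case second
    have "0 \<le> (real k - real n) * (4 - 4 * t) + real n * (2 - 4 * t)"
      using assms second by (intro add_nonneg_nonneg mult_nonneg_nonneg) auto
    then show ?thesis using assms second by (simp add: algebra_simps)
  next
    case third
    \<comment> \<open>The coefficient \<open>6 - 8 * t\<close> is
      \<open>(2 - 4 * t) + (4 - 4 * t)\<close>, the loss over one run of each shorter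
      length.\<close>
    have "0 \<le> (real k - 2 * real n) * (6 - 4 * t) + real n * (6 - 8 * t)"
      using assms third by (intro add_nonneg_nonneg mult_nonneg_nonneg) auto
    then show ?thesis using assms third by (simp add: algebra_simps)
  qed
qed (auto simp: algebra_simps)

lemma torus_upsilon_4_4n1_upper:
  assumes "1/2 \<le> t" "t \<le> 1"
  shows "torus_upsilon 4 (4 * n + 1) t = - 2 * real n - 2 * real n * t"
  unfolding torus_upsilon_4_4n1_eq_Max
proof (rule Max_image_atMost_eqI[where i = n], goal_cases)
  case (1 k)
  consider (first) "k \<le> n" | (second) "k > n" "k \<le> 2 * n" | (third) "k > 2 * n" by linarith
  then show ?case
  proof cases
    case first
    have "0 \<le> (real n - real k) * (4 * t - 2)"
      using assms first by (intro mult_nonneg_nonneg) auto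
    then show ?thesis using assms first by (simp add: algebra_simps)
  next
    case second
    have "0 \<le> (real k - real n) * (4 - 4 * t)"
      using assms second by (intro mult_nonneg_nonneg) auto
    then show ?thesis using assms second by (simp add: algebra_simps)
  next
    case third
    have "0 \<le> (real k - 2 * real n) * (6 - 4 * t) + real n * (4 - 4 * t)"
      using assms third by (intro add_nonneg_nonneg mult_nonneg_nonneg) auto
    then show ?thesis using assms third by (simp add: algebra_simps)
  qed
qed (auto simp: algebra_simps)

lemma torus_upsilon_4_4n1_symmetric:
  "torus_upsilon 4 (4 * n + 1) t = torus_upsilon 4 (4 * n + 1) (2 - t)"
  unfolding torus_upsilon_4_4n1_eq_Max
  by (rule Max_staircase_symmetric) (auto simp: of_nat_diff)

lemma torus_upsilon_4_4n3_lower: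
  assumes "0 \<le> t" "t \<le> 1/2"
  shows "torus_upsilon 4 (4 * n + 3) t = - (6 * real n + 3) * t"
  unfolding torus_upsilon_4_4n3_eq_Max
proof (rule Max_image_atMost_eqI[where i = 0], goal_cases)
  case (1 k)
  consider (first) "k \<le> n" | (second) "k > n" "k \<le> 2 * n + 1"
    | (third) "k > 2 * n + 1" by linarith
  then show ?case
  proof cases
    case first
    have "0 \<le> real k * (2 - 4 * t)"
      using assms first by (intro mult_nonneg_nonneg) auto
    then show ?thesis using assms first by (simp add: algebra_simps)
  next
    case second
    have "0 \<le> (real k - real n - 1) * (4 - 4 * t) + real n * (2 - 4 * t)"
      using assms second by (intro add_nonneg_nonneg mult_nonneg_nonneg) auto
    then show ?thesis using assms second by (simp add: algebra_simps)
  next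
    case third
    \<comment> \<open>What remains of the difference is \<open>(2 - 3 * t) + (4 - 3 * t)\<close>,
      from the two changes of length.\<close>
    have "0 \<le> (real k - 2 * real n - 2) * (6 - 4 * t) + real n * (6 - 8 * t)"
      using assms third by (intro add_nonneg_nonneg mult_nonneg_nonneg) auto
    then show ?thesis using assms third by (simp add: algebra_simps)
  qed
qed (auto simp: algebra_simps)

text \<open>Runs of length 1 inside their group no longer lower the term, but the step from
  \<open>n\<close> to \<open>n + 1\<close> changes it by \<open>3 * t - 2 \<le> 0\<close>, so the
  peak is at \<open>n\<close>.\<close>

lemma torus_upsilon_4_4n3_middle:
  assumes "1/2 \<le> t" "t \<le> 2/3"
  shows "torus_upsilon 4 (4 * n + 3) t = - 2 * real n - (2 * real n + 3) * t"
  unfolding torus_upsilon_4_4n3_eq_Max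
proof (rule Max_image_atMost_eqI[where i = n], goal_cases)
  case (1 k)
  consider (first) "k \<le> n" | (second) "k > n" "k \<le> 2 * n + 1"
    | (third) "k > 2 * n + 1" by linarith
  then show ?case
  proof cases
    case first
    have "0 \<le> (real n - real k) * (4 * t - 2)"
      using assms first by (intro mult_nonneg_nonneg) auto
    then show ?thesis using assms first by (simp add: algebra_simps)
  next
    case second
    have "0 \<le> (real k - real n - 1) * (4 - 4 * t)"
      using assms second by (intro mult_nonneg_nonneg) auto
    then show ?thesis using assms second by (simp add: algebra_simps)
  next
    case third
    have "0 \<le> (real k - 2 * real n - 2) * (6 - 4 * t) + real n * (4 - 4 * t)"
      using assms third by (intro add_nonneg_nonneg mult_nonneg_nonneg) auto
    then show ?thesis using assms third by (simp add: algebra_simps)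
  qed
qed (auto simp: algebra_simps)

text \<open>Now \<open>3 * t - 2\<close> is nonnegative, and the peak moves on to
  \<open>n + 1\<close>, the first run of length 2.\<close>

lemma torus_upsilon_4_4n3_upper:
  assumes "2/3 \<le> t" "t \<le> 1"
  shows "torus_upsilon 4 (4 * n + 3) t = - 2 * real n - 2 - 2 * real n * t"
  unfolding torus_upsilon_4_4n3_eq_Max
proof (rule Max_image_atMost_eqI[where i = "n + 1"], goal_cases)
  case (1 k)
  consider (first) "k \<le> n" | (second) "k > n" "k \<le> 2 * n + 1"
    | (third) "k > 2 * n + 1" by linarith
  then show ?case
  proof cases
    case first
    have "0 \<le> (real n - real k) * (4 * t - 2)"
      using assms first by (intro mult_nonneg_nonneg) auto
    then show ?thesis using assms first by (simp add: algebra_simps)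
  next
    case second
    have "0 \<le> (real k - real n - 1) * (4 - 4 * t)"
      using assms second by (intro mult_nonneg_nonneg) auto
    then show ?thesis using assms second by (simp add: algebra_simps)
  next
    case third
    have "0 \<le> (real k - 2 * real n - 2) * (6 - 4 * t) + real n * (4 - 4 * t)"
      using assms third by (intro add_nonneg_nonneg mult_nonneg_nonneg) auto
    then show ?thesis using assms third by (simp add: algebra_simps)
  qed
qed (auto simp: algebra_simps)

lemma torus_upsilon_4_4n3_symmetric:
  "torus_upsilon 4 (4 * n + 3) t = torus_upsilon 4 (4 * n + 3) (2 - t)"
  unfolding torus_upsilon_4_4n3_eq_Max
  by (rule Max_staircase_symmetric) (auto simp: of_nat_diff)

theorem mainTheorem7:
  fixes n :: nat
  assumes "n \<ge> 1"
  shows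
    "(\<forall>t::real.
        (0 \<le> t \<and> t \<le> 2/3 \<longrightarrow> torus_upsilon 3 (3*n+1) t = - 3 * real n * t) \<and>
        (2/3 \<le> t \<and> t \<le> 1 \<longrightarrow> torus_upsilon 3 (3*n+1) t = - 2 * real n)) \<and>
     (\<forall>t::real.
        (0 \<le> t \<and> t \<le> 2/3 \<longrightarrow> torus_upsilon 3 (3*n+2) t = - (3 * real n + 1) * t) \<and>
        (2/3 \<le> t \<and> t \<le> 1 \<longrightarrow> torus_upsilon 3 (3*n+2) t = - 2 * real n - t)) \<and>
     (\<forall>t::real.
        (0 \<le> t \<and> t \<le> 1/2 \<longrightarrow> torus_upsilon 4 (4*n+1) t = - 6 * real n * t) \<and>
        (1/2 \<le> t \<and> t \<le> 1 \<longrightarrow> torus_upsilon 4 (4*n+1) t = - 2 * real n - 2 * real n * t)) \<and>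
     (\<forall>t::real.
        (0 \<le> t \<and> t \<le> 1/2 \<longrightarrow> torus_upsilon 4 (4*n+3) t = - (6 * real n + 3) * t) \<and>
        (1/2 \<le> t \<and> t \<le> 2/3 \<longrightarrow>
           torus_upsilon 4 (4*n+3) t = - 2 * real n - (2 * real n + 3) * t) \<and>
        (2/3 \<le> t \<and> t \<le> 1 \<longrightarrow>
           torus_upsilon 4 (4*n+3) t = - 2 * real n - 2 - 2 * real n * t)) \<and>
     (\<forall>(p, q) \<in> {(3, 3*n+1), (3, 3*n+2), (4, 4*n+1), (4, 4*n+3)}.
        \<forall>t::real. 1 \<le> t \<and> t \<le> 2 \<longrightarrow> torus_upsilon p q t = torus_upsilon p q (2 - t))"
  using torus_upsilon_3_3n1_lower[of _ n] torus_upsilon_3_3n1_upper[of _ n]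
    torus_upsilon_3_3n2_lower[of _ n] torus_upsilon_3_3n2_upper[of _ n]
    torus_upsilon_4_4n1_lower[of _ n] torus_upsilon_4_4n1_upper[of _ n]
    torus_upsilon_4_4n3_lower[of _ n] torus_upsilon_4_4n3_middle[of _ n]
    torus_upsilon_4_4n3_upper[of _ n]
    torus_upsilon_3_3n1_symmetric[of n] torus_upsilon_3_3n2_symmetric[of n]
    torus_upsilon_4_4n1_symmetric[of n] torus_upsilon_4_4n3_symmetric[of n]
  by simp

end
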